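(* For all integers $n,p\ge 1$, the Sierpiński graph $S_p^n$ satisfies $$\gamma_{gr}(S_p^n)=p^{n-1}+\frac{p\,(p^{n-1}-1)}{2}.$$
   Context: Let $[p]_0=\{0,1,\ldots,p-1\}$ and $[n]=\{1,\ldots,n\}$. The Sierpiński graph $S_p^n$ has vertex set $[p]_0^n$, and two distinct vertices $u=(u_1,\ldots,u_n)$, $v=(v_1,\ldots,v_n)$ are adjacent if and only if there exists $h\in[n]$ such that $u_t=v_t$ for $t<h$, $u_h\neq v_h$, and $u_t=v_h$ and $v_t=u_h$ for all $t=h+1,\ldots,n$. For a vertex $v$, $N[v]$ denotes its closed neighborhood. A sequence $(v_1,\ldots,v_k)$ of distinct vertices of a graph $G$ is legal if $N[v_i]\setminus\bigcup_{j<i}N[v_j]\neq\emptyset$ for every $i$, and dominating if moreover $\{v_1,\ldots,v_k\}$ dominates $G$. The Grundy domination number $\gamma_{gr}(G)$ is the maximum length of a legal dominating sequence of $G$. *)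

theory Defs
  imports Complex_Main "Graph_Theory.Pair_Digraph"
begin

text \<open>
  A simple graph is a \<^locale>\<open>pair_graph\<close>: finite, loop-free, and with a symmetric set of
  arcs \<^const>\<open>parcs\<close> as its adjacency relation.
\<close>

definition closed_nbhd :: "'a pair_pre_digraph \<Rightarrow> 'a \<Rightarrow> 'a set" where
  "closed_nbhd G v = insert v {u. (v, u) \<in> parcs G}"

definition legal_seq :: "'a pair_pre_digraph \<Rightarrow> 'a list \<Rightarrow> bool" where
  "legal_seq G vs \<longleftrightarrow> set vs \<subseteq> pverts G \<and> distinct vs \<and>
     (\<forall>i < length vs. closed_nbhd G (vs ! i) - (\<Union>j<i. closed_nbhd G (vs ! j)) \<noteq> {})"

definition dominating_set :: "'a pair_pre_digraph \<Rightarrow> 'a set \<Rightarrow> bool" where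
  "dominating_set G D \<longleftrightarrow> D \<subseteq> pverts G \<and> (\<forall>u \<in> pverts G. \<exists>v \<in> D. u \<in> closed_nbhd G v)"

definition dominating_seq :: "'a pair_pre_digraph \<Rightarrow> 'a list \<Rightarrow> bool" where
  "dominating_seq G vs \<longleftrightarrow> legal_seq G vs \<and> dominating_set G (set vs)"

definition grundy_domination_number :: "'a pair_pre_digraph \<Rightarrow> nat" where
  "grundy_domination_number G = Max {length vs | vs. dominating_seq G vs}"

text \<open>
  Vertices are words of length \<open>n\<close> over the letters \<open>{0..<p}\<close>. List positions start at 0, so
  the coordinate written \<open>u\<^sub>t\<close> for \<open>t \<in> {1..n}\<close> is \<open>u ! (t - 1)\<close>.
\<close>

definition sierpinski_verts :: "nat \<Rightarrow> nat \<Rightarrow> nat list set" where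
  "sierpinski_verts p n = {u. length u = n \<and> set u \<subseteq> {0..<p}}"

definition sierpinski_adj :: "nat \<Rightarrow> nat list \<Rightarrow> nat list \<Rightarrow> bool" where
  "sierpinski_adj n u v \<longleftrightarrow> u \<noteq> v \<and>
     (\<exists>h<n. (\<forall>t<h. u ! t = v ! t) \<and> u ! h \<noteq> v ! h \<and>
        (\<forall>t. h < t \<and> t < n \<longrightarrow> u ! t = v ! h \<and> v ! t = u ! h))"

definition sierpinski_graph :: "nat \<Rightarrow> nat \<Rightarrow> nat list pair_pre_digraph" where
  "sierpinski_graph p n =
     \<lparr> pverts = sierpinski_verts p n,
       parcs = {(u, v). u \<in> sierpinski_verts p n \<and> v \<in> sierpinski_verts p n
                  \<and> sierpinski_adj n u v} \<rparr>"

lemma finite_sierpinski_verts: "finite (sierpinski_verts p n)"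
  using finite_lists_length_eq[of "{0..<p}" n]
  by (simp add: sierpinski_verts_def conj_commute)

lemma sierpinski_adj_sym: "sierpinski_adj n u v \<Longrightarrow> sierpinski_adj n v u"
  unfolding sierpinski_adj_def by metis

lemma pair_graph_sierpinski: "pair_graph (sierpinski_graph p n)"
proof -
  have "finite (parcs (sierpinski_graph p n))"
    by (rule finite_subset[of _ "sierpinski_verts p n \<times> sierpinski_verts p n"])
      (auto simp: sierpinski_graph_def finite_sierpinski_verts)
  then show ?thesis
    by unfold_locales
      (auto simp: sierpinski_graph_def finite_sierpinski_verts symmetric_def sym_def
        sierpinski_adj_def[of _ u u for u] intro: sierpinski_adj_sym)
qed

text \<open>
  The maximum in \<^const>\<open>grundy_domination_number\<close> is attained: a longest legal sequence is
  dominating, since any undominated vertex could be appended to it.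
\<close>

context pair_graph
begin

lemma finite_legal_lengths: "finite {length vs | vs. legal_seq G vs}"
proof (rule finite_subset)
  show "{length vs | vs. legal_seq G vs} \<subseteq> {..card (pverts G)}"
    by (auto simp: legal_seq_def) (metis card_mono distinct_card pair_finite_verts)
qed simp

lemma finite_dominating_lengths: "finite {length vs | vs. dominating_seq G vs}"
  by (rule finite_subset[OF _ finite_legal_lengths]) (auto simp: dominating_seq_def)

lemma dominating_lengths_nonempty: "{length vs | vs. dominating_seq G vs} \<noteq> {}"
proof -
  let ?L = "{length vs | vs. legal_seq G vs}"
  have "legal_seq G []" by (simp add: legal_seq_def)
  then have "?L \<noteq> {}" by blast
  then have "Max ?L \<in> ?L" by (rule Max_in[OF finite_legal_lengths])
  then obtain vs where vs: "legal_seq G vs" and max: "length vs = Max ?L" by auto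
  have "dominating_set G (set vs)"
  proof (rule ccontr)
    assume "\<not> dominating_set G (set vs)"
    then obtain u where u: "u \<in> pverts G" "\<forall>v \<in> set vs. u \<notin> closed_nbhd G v"
      using vs by (auto simp: dominating_set_def legal_seq_def)
    then have "u \<notin> set vs" by (auto simp: closed_nbhd_def)
    moreover have "u \<in> closed_nbhd G u" by (simp add: closed_nbhd_def)
    ultimately have "legal_seq G (vs @ [u])"
      using vs u by (fastforce simp: legal_seq_def nth_append less_Suc_eq)
    then have "length (vs @ [u]) \<le> Max ?L"
      by (intro Max_ge[OF finite_legal_lengths]) blast
    then show False using max by simp
  qed
  with vs show ?thesis by (auto simp: dominating_seq_def)
qed

end

end

theory Submission
  imports Defs "HOL-Library.List_Lexorder" "HOL-Library.Product_Lexorder"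
begin

text \<open>
  The vertices split into cliques \<open>K\<^sub>p\<close>, one for each word of length \<open>n - 1\<close>, and every vertex has at
  most one neighbour outside its clique. The \<open>p\<^sup>n\<^sup>-\<^sup>1\<close> cliques and the \<open>(p\<^sup>n - p) / 2\<close> edges between
  them cover all edges. Assign to each step of a legal sequence a member of this cover containing both
  the chosen vertex and a vertex that it newly dominates. Different steps get different members,
  because the first step in a clique dominates all of it. So the size of the cover is an upper bound.

  For a legal sequence of that length, go through the cliques in lexicographic order. In each clique,
  first take a vertex without neighbours in later cliques, which newly dominates a vertex without
  neighbours in earlier cliques; then take the vertices with a neighbour in a later clique, each of
  which newly dominates that neighbour. In the clique of a constant word \<open>j\<dots>j\<close> the extreme vertex
  serves for both; in the clique of \<open>q = w i j\<dots>j\<close> with \<open>i \<noteq> j\<close> one takes the vertices \<open>q j\<close> and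
  \<open>q i\<close>, one of which has its outer neighbour in an earlier clique and the other in a later one.
\<close>

section \<open>Legal sequences from vertices with assigned footprints\<close>

text \<open>Sorting \<open>D\<close> by \<open>key\<close> makes \<open>fp y\<close> new at the step
  of \<open>y\<close>. For equal keys \<open>new\<close> applies in both directions, so the order
  among ties does not matter.\<close>

lemma legal_seq_by_key:
  fixes key :: "'a \<Rightarrow> 'k::linorder"
  assumes fin: "finite D" and sub: "D \<subseteq> pverts G"
    and fp: "\<And>x. x \<in> D \<Longrightarrow> fp x \<in> closed_nbhd G x"
    and new: "\<And>x y. x \<in> D \<Longrightarrow> y \<in> D \<Longrightarrow> x \<noteq> y \<Longrightarrow> key x \<le> key y \<Longrightarrow> fp y \<notin> closed_nbhd G x"
  obtains vs where "legal_seq G vs" "set vs = D" "length vs = card D"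
proof -
  obtain ws where ws: "set ws = D" "distinct ws"
    using finite_distinct_list[OF fin] by blast
  define vs where "vs = sort_key key ws"
  have set: "set vs = D" and dist: "distinct vs" and len: "length vs = card D"
    using ws distinct_card[of ws] by (simp_all add: vs_def)
  have sorted: "sorted_wrt (\<lambda>x y. key x \<le> key y) vs"
    using sorted_sort_key[of key ws] by (simp add: sorted_map vs_def)
  have "fp (vs ! i) \<in> closed_nbhd G (vs ! i) - (\<Union>j<i. closed_nbhd G (vs ! j))"
    if i: "i < length vs" for i
  proof -
    have "fp (vs ! i) \<notin> closed_nbhd G (vs ! j)" if "j < i" for j
      using that i set dist sorted_wrt_nth_less[OF sorted that i]
      by (intro new) (auto simp: nth_eq_iff_index_eq)
    then show ?thesis using fp set i by auto
  qed
  then have "legal_seq G vs"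
    unfolding legal_seq_def using set sub dist by blast
  then show thesis using that set len by blast
qed

section \<open>Graphs partitioned into cliques with at most one outer edge per vertex\<close>

locale clique_partition = pair_graph G
  for G :: "'a pair_pre_digraph" and c :: "'a \<Rightarrow> 'k::linorder" +
  assumes clique: "x \<in> pverts G \<Longrightarrow> y \<in> pverts G \<Longrightarrow> c x = c y \<Longrightarrow> x \<noteq> y \<Longrightarrow> (x, y) \<in> parcs G"
    and outside_unique: "(x, y) \<in> parcs G \<Longrightarrow> (x, z) \<in> parcs G \<Longrightarrow> c x \<noteq> c y \<Longrightarrow> c x \<noteq> c z \<Longrightarrow> y = z"
begin

text \<open>Each edge between cliques is recorded by its endpoint in the smaller clique. By
  \<open>outside_unique\<close> no endpoint is shared, so \<open>card forward\<close> counts these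
  edges.\<close>

definition forward :: "'a set" where
  "forward = {x. \<exists>y. (x, y) \<in> parcs G \<and> c x < c y}"

definition backward :: "'a set" where
  "backward = {x. \<exists>y. (x, y) \<in> parcs G \<and> c y < c x}"

lemma forward_subset: "forward \<subseteq> pverts G"
  by (auto simp: forward_def wellformed')

lemma finite_forward: "finite forward"
  using forward_subset pair_finite_verts by (rule finite_subset)

lemma finite_backward: "finite backward"
  by (rule finite_subset[OF _ pair_finite_verts]) (auto simp: backward_def wellformed')

lemma forward_Int_backward: "forward \<inter> backward = {}"
  unfolding forward_def backward_def using outside_unique by fastforce

text \<open>The upward oriented outer edges \<open>A\<close> project bijectively onto their tails
  \<open>forward\<close> and onto their heads \<open>backward\<close>.\<close>

lemma card_backward: "card backward = card forward"
proof -
  define A where "A = {(x, y). (x, y) \<in> parcs G \<and> c x < c y}"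
  have "y = z" if "(x, y) \<in> A" "(x, z) \<in> A" for x y z
    using that outside_unique[of x y z] by (auto simp: A_def)
  then have "inj_on fst A"
    by (auto simp: inj_on_def)
  moreover have "x = y" if "(x, z) \<in> A" "(y, z) \<in> A" for x y z
    using that outside_unique[of z x y] by (auto simp: A_def arcs_symmetric)
  then have "inj_on snd A"
    by (auto simp: inj_on_def)
  moreover have "fst ` A = forward"
    by (force simp: A_def forward_def)
  moreover have "snd ` A = backward"
  proof -
    have "(x, y) \<in> parcs G \<longleftrightarrow> (y, x) \<in> parcs G" for x y
      using arcs_symmetric by metis
    then show ?thesis by (force simp: A_def backward_def)
  qed
  ultimately show ?thesis
    by (metis card_image)
qed

lemma twice_card_forward:
  "2 * card forward = card (forward \<union> backward)"
  using card_Un_disjoint[OF finite_forward finite_backward forward_Int_backward]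
  by (simp add: card_backward)

lemma legal_seq_length_le:
  assumes "legal_seq G vs"
  shows "length vs \<le> card (c ` pverts G) + card forward"
proof -
  have "\<exists>u. u \<in> closed_nbhd G (vs ! i) \<and> (\<forall>j<i. u \<notin> closed_nbhd G (vs ! j))"
    if "i < length vs" for i
    using assms that unfolding legal_seq_def by blast
  then obtain u where u: "\<And>i. i < length vs \<Longrightarrow> u i \<in> closed_nbhd G (vs ! i)"
    and new: "\<And>i j. i < length vs \<Longrightarrow> j < i \<Longrightarrow> u i \<notin> closed_nbhd G (vs ! j)"
    by metis
  have V: "vs ! i \<in> pverts G" if "i < length vs" for i
    using assms that unfolding legal_seq_def by auto
  \<comment> \<open>\<open>Inl\<close> stands for a clique, \<open>Inr\<close> for an outer edge,
    represented by its end in the smaller clique.\<close>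
  define label where "label i = (if c (u i) = c (vs ! i) then Inl (c (vs ! i))
    else Inr (if c (vs ! i) < c (u i) then vs ! i else u i))" for i
  have arc: "(vs ! i, u i) \<in> parcs G" if "i < length vs" "u i \<noteq> vs ! i" for i
    using u[OF that(1)] that(2) by (auto simp: closed_nbhd_def)
  have uV: "u i \<in> pverts G" if "i < length vs" for i
    using V[OF that] arc[OF that] wellformed'(2) by metis
  have "label i \<noteq> label j" if ij: "i < j" "j < length vs" for i j
  proof
    assume eq: "label i = label j"
    have i: "i < length vs" using ij by simp
    have far: "u j \<noteq> vs ! i" "(vs ! i, u j) \<notin> parcs G"
      using new[OF ij(2,1)] by (auto simp: closed_nbhd_def)
    show False
    proof (cases "c (u i) = c (vs ! i)")
      \<comment> \<open>Both steps use the same clique; \<open>vs ! i\<close> dominates all of it,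
        including \<open>u j\<close>.\<close>
      case True
      with eq have "c (vs ! i) = c (u j)"
        by (auto simp: label_def split: if_splits)
      then show False using far clique V[OF i] uV[OF ij(2)] by metis
    next
      case False
      with eq have *: "c (u j) \<noteq> c (vs ! j)" by (auto simp: label_def split: if_splits)
      note arcs = arc[OF i] arc[OF ij(2)]
      have "(vs ! i, u i) \<in> parcs G" "(u i, vs ! i) \<in> parcs G"
        "(vs ! j, u j) \<in> parcs G" "(u j, vs ! j) \<in> parcs G"
        using arcs False * arcs_symmetric by metis+
      \<comment> \<open>Equal labels mean two outer edges with the same lower end, hence the same
        edge by \<open>outside_unique\<close>. As \<open>vs ! i\<close> dominates both its ends,
        \<open>u j\<close> is not new.\<close>
      moreover have "u i = u j \<or> u i = vs ! j \<or> vs ! i = u j \<or> vs ! i = vs ! j"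
      proof -
        have "(if c (vs ! i) < c (u i) then vs ! i else u i) =
            (if c (vs ! j) < c (u j) then vs ! j else u j)"
          using eq False * by (simp only: label_def if_False sum.inject)
        then show ?thesis by presburger
      qed
      ultimately show False
        using False * far outside_unique[of "u i" "vs ! i" "u j"] by auto
    qed
  qed
  then have "inj_on label {..<length vs}"
    by (intro linorder_inj_onI) auto
  moreover have "label ` {..<length vs} \<subseteq> c ` pverts G <+> forward"
  proof
    fix l assume "l \<in> label ` {..<length vs}"
    then obtain i where i: "i < length vs" and l: "l = label i" by auto
    show "l \<in> c ` pverts G <+> forward"
    proof (cases "c (u i) = c (vs ! i)")
      case True
      then show ?thesis using V[OF i] by (auto simp: l label_def)
    next
      case False
      then have "(vs ! i, u i) \<in> parcs G" using arc[OF i] by metis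
      with False arcs_symmetric[OF this] show ?thesis
        by (auto simp: l label_def forward_def neq_iff)
    qed
  qed
  ultimately have "card {..<length vs} \<le> card (c ` pverts G <+> forward)"
    using finite_forward by (intro card_inj_on_le) auto
  then show ?thesis
    using finite_forward by (simp add: card_Plus)
qed

theorem grundy_domination_number_eq:
  assumes a: "\<And>q. q \<in> c ` pverts G \<Longrightarrow> a q \<in> pverts G \<and> c (a q) = q \<and> a q \<notin> forward"
    and b: "\<And>q. q \<in> c ` pverts G \<Longrightarrow> b q \<in> pverts G \<and> c (b q) = q \<and> b q \<notin> backward"
  shows "grundy_domination_number G = card (c ` pverts G) + card forward"
proof -
  let ?Q = "c ` pverts G"
  \<comment> \<open>\<open>a q\<close> is the vertex of clique \<open>q\<close> chosen first, and
    \<open>b q\<close> the vertex that it newly dominates.\<close>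
  define D where "D = a ` ?Q \<union> forward"
  define out where "out x = (SOME y. (x, y) \<in> parcs G \<and> c x < c y)" for x
  define fp where "fp x = (if x \<in> forward then out x else b (c x))" for x
  have out: "(x, out x) \<in> parcs G" "c x < c (out x)" if "x \<in> forward" for x
    using that someI_ex[of "\<lambda>y. (x, y) \<in> parcs G \<and> c x < c y"]
    unfolding forward_def out_def by blast+
  have cQ: "c x \<in> ?Q" if "x \<in> D" for x
    using that a forward_subset by (auto simp: D_def)
  have aD: "x = a (c x)" if "x \<in> D" "x \<notin> forward" for x
    using that a by (auto simp: D_def)
  have DV: "D \<subseteq> pverts G"
    using a forward_subset by (auto simp: D_def)
  have "fp x \<in> closed_nbhd G x" if x: "x \<in> D" for x
  proof (cases "x \<in> forward")
    case True
    then show ?thesis using out by (simp add: fp_def closed_nbhd_def)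
  next
    case False
    have "x \<in> pverts G" using DV x by blast
    then have "b (c x) = x \<or> (x, b (c x)) \<in> parcs G"
      using clique b[OF cQ[OF x]] by metis
    then show ?thesis using False by (auto simp: fp_def closed_nbhd_def)
  qed
  \<comment> \<open>As \<open>False < True\<close>, the key puts \<open>a q\<close> before the
    \<open>forward\<close> vertices of clique \<open>q\<close>.\<close>
  moreover have "fp y \<notin> closed_nbhd G x"
    if x: "x \<in> D" and y: "y \<in> D" and ne: "x \<noteq> y"
      and le: "(c x, x \<in> forward) \<le> (c y, y \<in> forward)" for x y
  proof (cases "y \<in> forward")
    case True
    have "c x \<le> c y" using le by auto
    then have lt: "c x < c (out y)" using out(2)[OF True] by simp
    \<comment> \<open>Both \<open>x\<close> and \<open>y\<close> lie in smaller cliques than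
      \<open>out y\<close>, which has only one outer neighbour.\<close>
    moreover have "(x, out y) \<notin> parcs G"
    proof
      assume "(x, out y) \<in> parcs G"
      then have "(out y, x) \<in> parcs G" "(out y, y) \<in> parcs G"
        using out(1)[OF True] by (simp_all add: arcs_symmetric)
      then have "x = y"
        using lt out(2)[OF True] by (intro outside_unique[of "out y"]) simp_all
      with ne show False ..
    qed
    ultimately show ?thesis using True by (auto simp: fp_def closed_nbhd_def)
  next
    case False
    \<comment> \<open>Within one clique the key would force \<open>x \<notin> forward\<close>, so
      \<open>x\<close> and \<open>y\<close> would both be its vertex \<open>a (c y)\<close>.\<close>
    have "c x \<noteq> c y" using aD[OF x] aD[OF y False] le False ne by auto
    then have lt: "c x < c y" using le by auto
    then have "(x, b (c y)) \<notin> parcs G"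
      using b[OF cQ[OF y]] arcs_symmetric[of x "b (c y)"] by (auto simp: backward_def)
    then show ?thesis using lt b[OF cQ[OF y]] False by (auto simp: fp_def closed_nbhd_def)
  qed
  moreover have "finite D"
    using DV pair_finite_verts by (rule finite_subset)
  ultimately obtain vs where vs: "legal_seq G vs" "set vs = D" "length vs = card D"
    using DV by (elim legal_seq_by_key[where key = "\<lambda>x. (c x, x \<in> forward)" and fp = fp]) auto
  \<comment> \<open>The vertices \<open>a q\<close> alone dominate the graph, each its own
    clique.\<close>
  have "u = a (c u) \<or> (a (c u), u) \<in> parcs G" if "u \<in> pverts G" for u
    using clique a that by (metis imageI)
  then have "u \<in> closed_nbhd G (a (c u))" if "u \<in> pverts G" for u
    using that by (auto simp: closed_nbhd_def)
  then have "dominating_set G D"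
    using DV unfolding dominating_set_def D_def by blast
  then have "dominating_seq G vs"
    using vs by (simp add: dominating_seq_def)
  moreover have "length vs = card ?Q + card forward"
  proof -
    have "inj_on a ?Q" using a by (metis inj_onI)
    moreover have "a ` ?Q \<inter> forward = {}" using a by blast
    ultimately show ?thesis
      using finite_forward by (simp add: vs D_def card_Un_disjoint card_image)
  qed
  ultimately have "card ?Q + card forward \<in> {length vs | vs. dominating_seq G vs}"
    by (metis (mono_tags, lifting) mem_Collect_eq)
  then show ?thesis
    unfolding grundy_domination_number_def
    using legal_seq_length_le
    by (intro Max_eqI[OF finite_dominating_lengths]) (auto simp: dominating_seq_def)
qed

end

section \<open>Cliques and outer edges of the Sierpinski graph\<close>

lemma sierpinski_graph_simps [simp]:
  "pverts (sierpinski_graph p n) = sierpinski_verts p n"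
  "(x, y) \<in> parcs (sierpinski_graph p n) \<longleftrightarrow>
     x \<in> sierpinski_verts p n \<and> y \<in> sierpinski_verts p n \<and> sierpinski_adj n x y"
  by (simp_all add: sierpinski_graph_def)

lemma card_sierpinski_verts: "card (sierpinski_verts p n) = p ^ n"
  using card_lists_length_eq[of "{0..<p}" n]
  by (simp add: sierpinski_verts_def conj_commute)

text \<open>The words differ in the last position only; with \<open>h = m\<close> the condition on
  later coordinates is vacuous.\<close>

lemma sierpinski_adj_same_butlast:
  assumes "length x = Suc m" "length y = Suc m" "butlast x = butlast y" "x \<noteq> y"
  shows "sierpinski_adj (Suc m) x y"
proof -
  have "x ! t = y ! t" if "t < m" for t
    using assms that by (metis nth_butlast length_butlast diff_Suc_1)
  moreover from this have "x ! m \<noteq> y ! m"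
    using assms by (metis nth_equalityI less_Suc_eq)
  ultimately show ?thesis
    using assms(4) unfolding sierpinski_adj_def by (intro conjI exI[of _ m]) auto
qed

text \<open>
  The coordinate where the neighbour outside the clique differs first is the last one whose entry is
  not the final letter.
\<close>

lemma sierpinski_outside_pos:
  assumes "sierpinski_adj (Suc m) x y" "length x = Suc m" "length y = Suc m" "butlast x \<noteq> butlast y"
  obtains h where "h < m" "x ! h \<noteq> x ! m" "\<And>t. h < t \<Longrightarrow> t \<le> m \<Longrightarrow> x ! t = x ! m"
    "y = take h x @ x ! m # replicate (m - h) (x ! h)"
proof -
  obtain h where h: "h < Suc m" "\<And>t. t < h \<Longrightarrow> x ! t = y ! t" "x ! h \<noteq> y ! h"
    "\<And>t. h < t \<Longrightarrow> t < Suc m \<Longrightarrow> x ! t = y ! h \<and> y ! t = x ! h"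
    using assms(1) unfolding sierpinski_adj_def by blast
  have "h \<noteq> m"
  proof
    assume "h = m"
    then have "butlast x ! t = butlast y ! t" if "t < m" for t
      using h(2)[of t] that assms(2,3) by (simp add: nth_butlast)
    then have "butlast x = butlast y"
      using assms(2,3) by (intro nth_equalityI) simp_all
    with assms(4) show False ..
  qed
  then have hm: "h < m" using h by simp
  then have yh: "y ! h = x ! m" using h(4)[of m] by simp
  have "y = take h x @ x ! m # replicate (m - h) (x ! h)"
  proof (rule nth_equalityI)
    fix i assume i: "i < length y"
    show "y ! i = (take h x @ x ! m # replicate (m - h) (x ! h)) ! i"
    proof (cases i h rule: linorder_cases)
      case less
      then show ?thesis using h(2)[of i] hm assms(2) by (simp add: nth_append)
    next
      case equal
      then show ?thesis using yh hm assms(2) by (simp add: nth_append)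
    next
      case greater
      then show ?thesis using h(4)[of i] i hm assms(2,3) by (simp add: nth_append nth_Cons')
    qed
  qed (use assms hm in simp)
  moreover have "x ! h \<noteq> x ! m" using h(3) yh by simp
  moreover have "x ! t = x ! m" if "h < t" "t \<le> m" for t
    using h(4)[OF that(1)] that(2) yh by simp
  ultimately show thesis using that[of h] hm by blast
qed

text \<open>Both neighbours arise at the last position of \<open>x\<close> whose entry differs from
  the final letter, and \<open>x\<close> with this position determines the neighbour.\<close>

lemma sierpinski_outside_unique:
  assumes "sierpinski_adj (Suc m) x y" "sierpinski_adj (Suc m) x z"
    and "length x = Suc m" "length y = Suc m" "length z = Suc m"
    and "butlast x \<noteq> butlast y" "butlast x \<noteq> butlast z"
  shows "y = z"
proof -
  obtain h where h: "h < m" "x ! h \<noteq> x ! m" "\<And>t. h < t \<Longrightarrow> t \<le> m \<Longrightarrow> x ! t = x ! m"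
    "y = take h x @ x ! m # replicate (m - h) (x ! h)"
    using sierpinski_outside_pos assms by metis
  obtain k where k: "k < m" "x ! k \<noteq> x ! m" "\<And>t. k < t \<Longrightarrow> t \<le> m \<Longrightarrow> x ! t = x ! m"
    "z = take k x @ x ! m # replicate (m - k) (x ! k)"
    using sierpinski_outside_pos assms by metis
  have "h = k"
    using h(1,2,3) k(1,2,3) by (metis linorder_cases less_imp_le)
  then show ?thesis using h(4) k(4) by simp
qed

lemma clique_partition_sierpinski: "clique_partition (sierpinski_graph p (Suc m)) butlast"
proof -
  interpret pair_graph "sierpinski_graph p (Suc m)" by (rule pair_graph_sierpinski)
  show ?thesis
  proof
    show "(x, y) \<in> parcs (sierpinski_graph p (Suc m))"
      if "x \<in> pverts (sierpinski_graph p (Suc m))" "y \<in> pverts (sierpinski_graph p (Suc m))"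
        "butlast x = butlast y" "x \<noteq> y" for x y
      using that sierpinski_adj_same_butlast[of x m y] by (simp add: sierpinski_verts_def)
    show "y = z"
      if "(x, y) \<in> parcs (sierpinski_graph p (Suc m))" "(x, z) \<in> parcs (sierpinski_graph p (Suc m))"
        "butlast x \<noteq> butlast y" "butlast x \<noteq> butlast z" for x y z
      using that sierpinski_outside_unique[of m x y z] by (simp add: sierpinski_verts_def)
  qed
qed

section \<open>Direction of outer edges in the lexicographic order\<close>

text \<open>For \<open>k > 0\<close> these are edges between cliques; the words first differ right
  after \<open>w\<close>.\<close>

lemma sierpinski_adj_swap:
  assumes "i \<noteq> j"
  shows "sierpinski_adj (length w + Suc k) (w @ i # replicate k j) (w @ j # replicate k i)"
  unfolding sierpinski_adj_def using assms
  by (auto intro!: exI[of _ "length w"] simp: nth_append nth_Cons')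

lemma butlast_append_replicate:
  "butlast (w @ i # replicate (Suc k) j) = w @ i # replicate k j"
  by (simp add: butlast_append flip: replicate_append_same)

lemma append_Cons_less_iff:
  fixes i j :: nat
  assumes "i \<noteq> j"
  shows "w @ i # u < w @ j # v \<longleftrightarrow> i < j"
  using assms by (induction w) auto

text \<open>The split is at the last entry that differs from the final letter. The block after it
  contains the final letter, hence its length is a successor.\<close>

lemma constant_or_split_last:
  assumes "x \<noteq> []"
  obtains (const) "x = replicate (length x) (last x)"
  | (split) w i k where "i \<noteq> last x" "x = w @ i # replicate (Suc k) (last x)"
proof (cases "\<exists>y\<in>set x. y \<noteq> last x")
  case True
  then obtain w i u where x: "x = w @ i # u" and i: "i \<noteq> last x" and "\<forall>y\<in>set u. \<not> y \<noteq> last x"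
    by (rule split_list_last_propE)
  then have u: "u = replicate (length u) (last x)"
    by (simp add: replicate_length_same)
  have "length u \<noteq> 0" using x i by auto
  then obtain k where "length u = Suc k" using not0_implies_Suc by blast
  then show thesis using split i x u by metis
next
  case False
  then have "x = replicate (length x) (last x)"
    by (simp add: replicate_length_same)
  then show thesis by (rule const)
qed

context
  fixes p m :: nat
begin

interpretation clique_partition "sierpinski_graph p (Suc m)" butlast
  by (rule clique_partition_sierpinski)

text \<open>A constant word has no entry that differs from its final letter, so there is nothing to
  exchange.\<close>

lemma replicate_not_forward_backward: "replicate (Suc m) j \<notin> forward \<union> backward"
proof
  assume "replicate (Suc m) j \<in> forward \<union> backward"
  then obtain y where y: "sierpinski_adj (Suc m) (replicate (Suc m) j) y" "length y = Suc m"
    "butlast (replicate (Suc m) j) \<noteq> butlast y"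
    by (auto simp: forward_def backward_def sierpinski_verts_def neq_iff simp del: replicate_Suc)
  obtain h where "h < m" "replicate (Suc m) j ! h \<noteq> replicate (Suc m) j ! m"
    using sierpinski_outside_pos[OF y(1) length_replicate y(2,3)] by metis
  then show False by (simp del: replicate_Suc)
qed

text \<open>The outer neighbour exchanges \<open>i\<close> with the block of \<open>j\<close>, so
  the words of the two cliques first differ where \<open>i\<close> is opposed to
  \<open>j\<close>.\<close>

lemma split_forward_iff:
  assumes "i \<noteq> j" "w @ i # replicate (Suc k) j \<in> sierpinski_verts p (Suc m)"
  shows "w @ i # replicate (Suc k) j \<in> forward \<longleftrightarrow> i < j"
    and "w @ i # replicate (Suc k) j \<in> backward \<longleftrightarrow> j < i"
proof -
  let ?x = "w @ i # replicate (Suc k) j" and ?y = "w @ j # replicate (Suc k) i"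
  have less: "butlast ?x < butlast ?y \<longleftrightarrow> i < j" "butlast ?y < butlast ?x \<longleftrightarrow> j < i"
    unfolding butlast_append_replicate using append_Cons_less_iff assms(1) by metis+
  have arc: "(?x, ?y) \<in> parcs (sierpinski_graph p (Suc m))"
  proof -
    have "Suc m = length w + Suc (Suc k)" using assms(2) by (simp add: sierpinski_verts_def)
    then show ?thesis
      using assms sierpinski_adj_swap[OF assms(1), of w "Suc k"] by (auto simp: sierpinski_verts_def)
  qed
  have "i < j \<Longrightarrow> ?x \<in> forward" "j < i \<Longrightarrow> ?x \<in> backward"
    unfolding forward_def backward_def using arc less by blast+
  \<comment> \<open>The converses hold because the two sets are disjoint and
    \<open>i \<noteq> j\<close>.\<close>
  then show "?x \<in> forward \<longleftrightarrow> i < j" "?x \<in> backward \<longleftrightarrow> j < i"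
    using forward_Int_backward assms(1) by (metis disjoint_iff linorder_cases less_asym)+
qed

text \<open>Exactly the \<open>p\<close> constant words have no outer edge.\<close>

lemma card_forward_Un_backward: "card (forward \<union> backward) + p = p ^ Suc m"
proof -
  let ?C = "replicate (Suc m) ` {0..<p}"
  have "forward \<union> backward \<union> ?C = sierpinski_verts p (Suc m)"
  proof (intro equalityI subsetI)
    fix x assume x: "x \<in> sierpinski_verts p (Suc m)"
    then have len: "length x = Suc m" and "set x \<subseteq> {0..<p}" and ne: "x \<noteq> []"
      by (auto simp: sierpinski_verts_def)
    then have last: "last x \<in> {0..<p}" using last_in_set by blast
    from ne show "x \<in> forward \<union> backward \<union> ?C"
    proof (cases x rule: constant_or_split_last)
      case const
      then show ?thesis using len last by auto
    next
      case (split w i k)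
      then show ?thesis using split_forward_iff[of i "last x" w k] x by (metis UnI1 UnI2 linorder_cases)
    qed
  qed (auto simp: forward_def backward_def sierpinski_verts_def)
  moreover have "(forward \<union> backward) \<inter> ?C = {}"
    using replicate_not_forward_backward by blast
  moreover have "card ?C = p"
    by (simp add: card_image inj_on_def)
  ultimately show ?thesis
    using card_Un_disjoint[of "forward \<union> backward" ?C] finite_forward finite_backward
    by (simp add: card_sierpinski_verts)
qed

lemma ex_not_forward_and_not_backward:
  assumes q: "q \<in> sierpinski_verts p m" and p: "p \<ge> 1"
  shows "(\<exists>x \<in> sierpinski_verts p (Suc m). butlast x = q \<and> x \<notin> forward) \<and>
    (\<exists>x \<in> sierpinski_verts p (Suc m). butlast x = q \<and> x \<notin> backward)"
proof -
  have snoc: "q @ [j] \<in> sierpinski_verts p (Suc m)" if "j < p" for j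
    using q that by (simp add: sierpinski_verts_def)
  have "\<exists>i j. i < p \<and> j < p \<and> q @ [i] \<notin> forward \<and> q @ [j] \<notin> backward"
  proof -
    consider (const) j where "j < p" "q = replicate m j"
      | (split) w i j k where "i \<noteq> j" "q = w @ i # replicate (Suc k) j"
    proof (cases "q = []")
      case True
      \<comment> \<open>For the empty word any letter would do; \<open>p \<ge> 1\<close> provides
        the letter 0.\<close>
      then show thesis using that(1)[of 0] p q by (simp add: sierpinski_verts_def)
    next
      case False
      then have "last q < p" "length q = m"
        using q last_in_set[of q] by (auto simp: sierpinski_verts_def subset_iff)
      with False show thesis
        by (cases q rule: constant_or_split_last) (use that in metis)+
    qed
    then show ?thesis
    proof cases
      case const
      then have "q @ [j] = replicate (Suc m) j"
        by (simp add: replicate_append_same)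
      then have "q @ [j] \<notin> forward \<and> q @ [j] \<notin> backward"
        using replicate_not_forward_backward[of j] by simp
      then show ?thesis using const by blast
    next
      case split
      have ij: "i < p" "j < p" using q split by (auto simp: sierpinski_verts_def)
      have j: "q @ [j] = w @ i # replicate (Suc (Suc k)) j"
        by (simp add: split replicate_append_same)
      \<comment> \<open>Here the split is at the last letter \<open>j\<close> of \<open>q\<close>,
        which reverses the roles of \<open>i\<close> and \<open>j\<close>.\<close>
      have i: "q @ [i] = (w @ i # replicate k j) @ j # replicate (Suc 0) i"
        by (simp add: split flip: replicate_append_same)
      have "q @ [j] \<in> forward \<longleftrightarrow> i < j" "q @ [j] \<in> backward \<longleftrightarrow> j < i"
        using split_forward_iff split(1) snoc[OF ij(2)] unfolding j by metis+
      moreover have "q @ [i] \<in> forward \<longleftrightarrow> j < i" "q @ [i] \<in> backward \<longleftrightarrow> i < j"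
        using split_forward_iff split(1)[symmetric] snoc[OF ij(1)] unfolding i by metis+
      ultimately show ?thesis using ij by (metis less_asym)
    qed
  qed
  then show ?thesis using snoc by (metis butlast_snoc)
qed

section \<open>Counting cliques and outer edges\<close>

lemma butlast_sierpinski_verts:
  assumes "p \<ge> 1"
  shows "butlast ` sierpinski_verts p (Suc m) = sierpinski_verts p m"
proof (intro equalityI subsetI)
  fix q assume "q \<in> sierpinski_verts p m"
  then show "q \<in> butlast ` sierpinski_verts p (Suc m)"
    using ex_not_forward_and_not_backward assms by blast
qed (auto simp: sierpinski_verts_def dest: in_set_butlastD)

text \<open>Doubling and adding \<open>p\<close> avoids division and truncated subtraction, since
  \<open>2 * card forward + p = p ^ Suc m\<close>.\<close>

lemma grundy_domination_number_sierpinski_Suc: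
  assumes "p \<ge> 1"
  shows "2 * grundy_domination_number (sierpinski_graph p (Suc m)) + p = 2 * p ^ m + p ^ Suc m"
proof -
  let ?V = "sierpinski_verts p (Suc m)"
  obtain a b where
    "\<And>q. q \<in> sierpinski_verts p m \<Longrightarrow> a q \<in> ?V \<and> butlast (a q) = q \<and> a q \<notin> forward"
    "\<And>q. q \<in> sierpinski_verts p m \<Longrightarrow> b q \<in> ?V \<and> butlast (b q) = q \<and> b q \<notin> backward"
    using ex_not_forward_and_not_backward assms by metis
  then have "grundy_domination_number (sierpinski_graph p (Suc m)) = p ^ m + card forward"
    using grundy_domination_number_eq[of a b]
    by (simp add: butlast_sierpinski_verts[OF assms] card_sierpinski_verts)
  then show ?thesis
    using card_forward_Un_backward twice_card_forward by simp
qed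

end

theorem theorem3p1:
  fixes n p :: nat
  assumes "n \<ge> 1" and "p \<ge> 1"
  shows "real (grundy_domination_number (sierpinski_graph p n)) =
    real p ^ (n - 1) + real p * (real p ^ (n - 1) - 1) / 2"
proof -
  obtain m where n: "n = Suc m" using assms(1) by (cases n) auto
  have "real (2 * grundy_domination_number (sierpinski_graph p n) + p) = real (2 * p ^ m + p ^ Suc m)"
    unfolding n using grundy_domination_number_sierpinski_Suc[OF assms(2)] by simp
  then show ?thesis by (simp add: n field_simps)
qed

end
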